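(* For the two-weight OWNM problem with parameter $U>1$, the competitive ratio of every deterministic online algorithm is at most $\frac13+\frac{2}{3U+3}$.
   Context: Online Weighted Non-Crossing Matching (OWNM): the input is a sequence $p_1,\dots,p_{2n}$ of points in the Euclidean plane in general position, revealed online one at a time; when $p_i$ arrives its weight $w(p_i)>0$ is revealed. Upon arrival of $p_i$ an online algorithm must irrevocably either leave $p_i$ unmatched or match it with a previously arrived, currently unmatched point, subject to the constraint that the straight-line segments joining matched pairs are pairwise non-crossing. The profit $\textsc{ALG}(I)$ is the total weight of matched points, and $\textsc{OPT}(I)=\sum_i w(p_i)$. A deterministic algorithm is $\rho$-competitive if there is a constant $c$ with $\textsc{ALG}(I)\ge\rho\,\textsc{OPT}(I)-c$ for all inputs $I$; its competitive ratio is the supremum of such $\rho$. In the two-weight OWNM, every weight is either $1$ or $U$, where $U>1$ is known to the algorithm. *)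

theory Defs
  imports "HOL-Analysis.Analysis" "HOL-Library.Extended_Real"
begin

type_synonym point = "real \<times> real"

text \<open>A request is a point together with its weight; list order is order of arrival.\<close>

type_synonym request = "point \<times> real"

definition general_position :: "point list \<Rightarrow> bool" where
  "general_position ps \<longleftrightarrow> distinct ps \<and>
     (\<forall>a\<in>set ps. \<forall>b\<in>set ps. \<forall>c\<in>set ps.
        a \<noteq> b \<and> b \<noteq> c \<and> a \<noteq> c \<longrightarrow> \<not> collinear {a, b, c})"

definition ownm_input :: "request list \<Rightarrow> bool" where
  "ownm_input I \<longleftrightarrow> even (length I) \<and> general_position (map fst I) \<and> (\<forall>r\<in>set I. snd r > 0)"

definition two_weight_input :: "real \<Rightarrow> request list \<Rightarrow> bool" where
  "two_weight_input U I \<longleftrightarrow> ownm_input I \<and> (\<forall>r\<in>set I. snd r = 1 \<or> snd r = U)"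

text \<open>
  A deterministic online strategy maps the requests seen so far, the newest one being the last
  element of the list, to its irrevocable decision on the newest point: leave it unmatched
  (\<open>None\<close>), or match it with the point of 0-based index \<open>j\<close> (\<open>Some j\<close>). Earlier decisions
  need not be an argument, as they are determined by the prefixes of the list. The total length of
  the input is not revealed.
\<close>

type_synonym strategy = "request list \<Rightarrow> nat option"

definition matching :: "strategy \<Rightarrow> request list \<Rightarrow> (nat \<times> nat) set" where
  "matching A I = {(j, i). i < length I \<and> A (take (Suc i) I) = Some j}"

definition edge_segment :: "request list \<Rightarrow> nat \<times> nat \<Rightarrow> point set" where
  "edge_segment I e = closed_segment (fst (I ! fst e)) (fst (I ! snd e))"

text \<open>
  The pairs in \<open>matching A I\<close> carry the index of the later endpoint second, so vertex-disjointness
  of the final matching together with \<open>j < i\<close> says precisely that every arriving point is matched,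
  if at all, with a point that arrived before it and is still unmatched at that moment.
\<close>

definition valid_run :: "strategy \<Rightarrow> request list \<Rightarrow> bool" where
  "valid_run A I \<longleftrightarrow>
     (\<forall>(j, i)\<in>matching A I. j < i) \<and>
     (\<forall>e\<in>matching A I. \<forall>f\<in>matching A I. e \<noteq> f \<longrightarrow>
        {fst e, snd e} \<inter> {fst f, snd f} = {} \<and>
        edge_segment I e \<inter> edge_segment I f = {})"

definition two_weight_algorithm :: "real \<Rightarrow> strategy \<Rightarrow> bool" where
  "two_weight_algorithm U A \<longleftrightarrow> (\<forall>I. two_weight_input U I \<longrightarrow> valid_run A I)"

definition matched :: "strategy \<Rightarrow> request list \<Rightarrow> nat set" where
  "matched A I = fst ` matching A I \<union> snd ` matching A I"

definition ALG :: "strategy \<Rightarrow> request list \<Rightarrow> real" where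
  "ALG A I = (\<Sum>k\<in>matched A I. snd (I ! k))"

text \<open>
  An even number of points in general position always has a perfect non-crossing matching, so the
  optimal profit is the total weight.
\<close>

definition OPT :: "request list \<Rightarrow> real" where
  "OPT I = (\<Sum>k<length I. snd (I ! k))"

definition competitive :: "real \<Rightarrow> strategy \<Rightarrow> real \<Rightarrow> bool" where
  "competitive U A \<rho> \<longleftrightarrow> (\<exists>c. \<forall>I. two_weight_input U I \<longrightarrow> ALG A I \<ge> \<rho> * OPT I - c)"

text \<open>The supremum is taken in \<^typ>\<open>ereal\<close>, where it is meaningful for every set.\<close>

definition competitive_ratio :: "real \<Rightarrow> strategy \<Rightarrow> ereal" where
  "competitive_ratio U A = Sup {ereal \<rho> | \<rho>. competitive U A \<rho>}"

end

theory Submission imports Defs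
begin

text \<open>
  The adversary keeps track of regions of the plane in which new points see only a known set of
  unmatched points. An edge with the newest point \<open>p\<close> splits its region into two: the new regions
  lie close to \<open>p\<close> on the two sides of the edge, which hides everything on the other side.

  Write \<open>\<rho>\<close> for the bound and \<open>D = 2 - 2\<rho>\<close>. The invariant is that the profit is at most
  \<open>\<rho> OPT + D (m - 1) - \<rho> k\<close>, where \<open>m\<close> is the number of open regions and \<open>k\<close> the number of unmatched
  points in them, all of weight \<open>1\<close>. Sending points of weight \<open>1\<close> to an open region preserves it. Closing a region must therefore cost the algorithm at least \<open>D\<close>. A region with four
  unmatched points of weight \<open>1\<close> loses \<open>4\<rho> \<ge> D\<close>. A region with at most one is sent a point of
  weight \<open>U\<close>; if the algorithm matches it, two more such points are wasted in the two empty parts,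
  and \<open>3\<rho>(U + 1) = U + 3\<close> says that this balances exactly. A region with at most three points that
  is split leaves a part with at most one, so all but at most two regions can be closed, and the
  game never ends.
\<close>

section \<open>Blocking segments\<close>

text \<open>The determinant of \<open>q - p\<close> and \<open>z - p\<close>: its sign tells on
  which side of the line through \<open>p\<close> and \<open>q\<close> the point \<open>z\<close>
  lies.\<close>

definition cross_from :: "point \<Rightarrow> point \<Rightarrow> point \<Rightarrow> real" where
  "cross_from p q z = (fst q - fst p) * (snd z - snd p) - (snd q - snd p) * (fst z - fst p)"

text \<open>The inner product of \<open>q - p\<close> and \<open>z - p\<close>. As
  \<open>along p q q\<close> is the squared length of the segment, values between 0 and
  \<open>along p q q\<close> mean that \<open>z\<close> projects onto it.\<close>

definition along :: "point \<Rightarrow> point \<Rightarrow> point \<Rightarrow> real" where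
  "along p q z = (fst q - fst p) * (fst z - fst p) + (snd q - snd p) * (snd z - snd p)"

lemma along_end_pos: "p \<noteq> q \<Longrightarrow> along p q q > 0"
proof -
  assume "p \<noteq> q"
  then have "fst q - fst p \<noteq> 0 \<or> snd q - snd p \<noteq> 0" by (auto simp: prod_eq_iff)
  then show ?thesis unfolding along_def
    by (metis not_sum_squares_lt_zero not_less_iff_gr_or_eq sum_squares_gt_zero_iff)
qed

lemma cross_from_combination:
  "cross_from p q ((1 - t) *\<^sub>R x + t *\<^sub>R y) = (1 - t) * cross_from p q x + t * cross_from p q y"
  by (simp add: cross_from_def algebra_simps)

lemma along_combination:
  "along p q ((1 - t) *\<^sub>R x + t *\<^sub>R y) = (1 - t) * along p q x + t * along p q y"
  by (simp add: along_def algebra_simps)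

lemma on_line_eq:
  assumes "p \<noteq> q" "cross_from p q z = 0"
  defines "s \<equiv> along p q z / along p q q"
  shows "z = (1 - s) *\<^sub>R p + s *\<^sub>R q"
proof -
  let ?L = "along p q q"
  have L: "?L > 0" using along_end_pos assms(1) by blast
  have s: "s * ?L = along p q z" using L by (simp add: s_def)
  \<comment> \<open>Up to the factor \<open>?L\<close>, \<open>z - p\<close> is expanded in the
    orthogonal basis formed by \<open>q - p\<close> and its quarter turn.\<close>
  have 1: "?L * (fst z - fst p) = along p q z * (fst q - fst p) - cross_from p q z * (snd q - snd p)"
    by (simp add: along_def cross_from_def algebra_simps)
  have 2: "?L * (snd z - snd p) = along p q z * (snd q - snd p) + cross_from p q z * (fst q - fst p)"
    by (simp add: along_def cross_from_def algebra_simps)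
  have "?L * (fst z - fst p) = ?L * (s * (fst q - fst p))"
    using 1 assms(2) by (simp add: mult.left_commute mult.assoc flip: s)
  moreover have "?L * (snd z - snd p) = ?L * (s * (snd q - snd p))"
    using 2 assms(2) by (simp add: mult.left_commute mult.assoc flip: s)
  ultimately have "fst z - fst p = s * (fst q - fst p)" "snd z - snd p = s * (snd q - snd p)"
    using L by simp_all
  then show ?thesis by (simp add: prod_eq_iff algebra_simps)
qed

lemma cross_from_zero_collinear:
  assumes "p \<noteq> q" "cross_from p q z = 0"
  shows "collinear {p, q, z}"
proof -
  have "\<exists>s. z = (1 - s) *\<^sub>R p + s *\<^sub>R q" using on_line_eq[OF assms] by blast
  then obtain s where s: "z = (1 - s) *\<^sub>R p + s *\<^sub>R q" by blast
  have "collinear {p, z, q}"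
    unfolding collinear_3_expand using s by (metis add.commute add_diff_cancel_left' diff_add_cancel)
  then show ?thesis by (simp add: insert_commute)
qed

text \<open>The two inequalities say that the point where the segment from \<open>x\<close> to \<open>y\<close> crosses the line
  through \<open>p\<close> and \<open>q\<close> lies between \<open>p\<close> and \<open>q\<close>, after multiplication by the positive
  denominator.\<close>

lemma segments_meet:
  assumes "p \<noteq> q" "cross_from p q x > 0" "cross_from p q y < 0"
    and "0 \<le> cross_from p q x * along p q y - cross_from p q y * along p q x"
    and "cross_from p q x * along p q y - cross_from p q y * along p q x
           \<le> (cross_from p q x - cross_from p q y) * along p q q"
  shows "closed_segment x y \<inter> closed_segment p q \<noteq> {}"
proof -
  define cx cy where "cx = cross_from p q x" and "cy = cross_from p q y"
  \<comment> \<open>The parameter at which the affine function \<open>cross_from p q\<close>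
    vanishes on the way from \<open>x\<close> to \<open>y\<close>.\<close>
  define t where "t = cx / (cx - cy)"
  define z where "z = (1 - t) *\<^sub>R x + t *\<^sub>R y"
  have pos: "cx > 0" "cy < 0" using assms by (simp_all add: cx_def cy_def)
  then have t: "0 \<le> t" "t \<le> 1" and t1: "1 - t = - cy / (cx - cy)"
    by (simp_all add: t_def field_simps)
  have "cross_from p q z = (1 - t) * cx + t * cy"
    by (simp add: z_def cross_from_combination cx_def cy_def)
  also have "\<dots> = 0" unfolding t1 using pos by (simp add: t_def field_simps)
  finally have c0: "cross_from p q z = 0" .
  have L: "along p q q > 0" using along_end_pos assms(1) by blast
  have az: "along p q z = (cx * along p q y - cy * along p q x) / (cx - cy)"
    unfolding z_def along_combination unfolding t1 by (simp add: t_def diff_divide_distrib add_divide_distrib)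
  have a0: "0 \<le> along p q z" using assms(4) pos unfolding az by (simp add: cx_def cy_def)
  have a1: "along p q z \<le> along p q q"
    using assms(5) pos unfolding az by (simp add: cx_def cy_def pos_divide_le_eq mult.commute)
  have "z \<in> closed_segment p q"
    unfolding in_segment using on_line_eq[OF assms(1) c0] a0 a1 L
    by (intro exI[of _ "along p q z / along p q q"]) auto
  moreover have "z \<in> closed_segment x y"
    unfolding in_segment using t z_def by blast
  ultimately show ?thesis by blast
qed

text \<open>Let \<open>m\<close> lie strictly inside the segment from \<open>p\<close> to
  \<open>q\<close>. A segment from a point near \<open>m\<close> to a fixed point strictly across
  the line crosses that line near \<open>m\<close>. This is an open condition on the starting point,
  so the finitely many points of \<open>F\<close> leave a common neighbourhood, whose two halves are
  the new windows. Taking \<open>m\<close> close to \<open>p\<close> keeps them inside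
  \<open>W\<close>.\<close>

lemma split_window:
  fixes W F :: "point set"
  assumes "open W" "p \<in> W" "p \<noteq> q" "finite F" "\<And>y. y \<in> F \<Longrightarrow> \<not> collinear {p, q, y}"
  obtains W1 W2 F1 F2 where "open W1" "open W2" "W1 \<noteq> {}" "W2 \<noteq> {}" "W1 \<subseteq> W" "W2 \<subseteq> W"
    "F1 \<union> F2 = F" "F1 \<inter> F2 = {}"
    "\<forall>x\<in>W1. \<forall>y\<in>W2 \<union> F2. closed_segment x y \<inter> closed_segment p q \<noteq> {}"
    "\<forall>x\<in>W2. \<forall>y\<in>F1. closed_segment x y \<inter> closed_segment p q \<noteq> {}"
proof -
  let ?c = "cross_from p q" and ?d = "along p q"
  let ?L = "?d q"
  have L: "?L > 0" using along_end_pos assms(3) by blast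
  have cont [continuous_intros]: "continuous_on S ?c" "continuous_on S ?d" for S
    unfolding cross_from_def along_def by (intro continuous_intros)+
  define F1 where "F1 = {y \<in> F. ?c y > 0}"
  define F2 where "F2 = {y \<in> F. ?c y < 0}"
  have nz: "?c y \<noteq> 0" if "y \<in> F" for y
    using cross_from_zero_collinear assms(3,5) that by blast
  \<comment> \<open>The two inequalities of \<open>segments_meet\<close>, made strict so that
    \<open>N y\<close> is open. The factor \<open>- sgn (?c y)\<close> exchanges the roles of
    \<open>x\<close> and \<open>y\<close> when \<open>y\<close> lies on the positive side.\<close>
  define N where "N y = {x. 0 < (?c x * ?d y - ?c y * ?d x) * (- sgn (?c y)) \<and>
    (?c x * ?d y - ?c y * ?d x) * (- sgn (?c y)) < (?c x - ?c y) * (- sgn (?c y)) * ?L}" for y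
  have openN: "open (N y)" for y
    unfolding N_def by (intro open_Collect_conj open_Collect_less continuous_intros)
  \<comment> \<open>The bounds on \<open>?d\<close> serve pairs of new points: a segment joining two
    points of \<open>V\<close> on opposite sides crosses the line between \<open>p\<close> and
    \<open>q\<close>.\<close>
  define V where "V = W \<inter> {x. 0 < ?d x \<and> ?d x < ?L} \<inter> (\<Inter>y\<in>F. N y)"
  have openV: "open V"
    unfolding V_def using openN assms(1,4)
    by (intro open_Int open_INT open_Collect_conj open_Collect_less continuous_intros) auto
  obtain e where e: "e > 0" "ball p e \<subseteq> W" using assms(1,2) open_contains_ball by blast
  \<comment> \<open>The bound \<open>1/2\<close> keeps \<open>m\<close> strictly between
    \<open>p\<close> and \<open>q\<close>, the other one keeps it within \<open>e / 2\<close> of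
    \<open>p\<close>.\<close>
  define \<delta> where "\<delta> = min (1/2) (e / (2 * norm (q - p)))"
  have nqp: "norm (q - p) > 0" using assms(3) by simp
  have \<delta>: "0 < \<delta>" "\<delta> < 1" using e nqp by (auto simp: \<delta>_def)
  define m where "m = (1 - \<delta>) *\<^sub>R p + \<delta> *\<^sub>R q"
  have "dist p m = \<delta> * norm (q - p)"
  proof -
    have "p - m = \<delta> *\<^sub>R (p - q)" by (simp add: m_def algebra_simps)
    then show ?thesis using \<delta> by (simp add: dist_norm norm_minus_commute)
  qed
  also have "\<dots> \<le> e / 2"
    using nqp by (simp add: \<delta>_def min_def field_simps)
  finally have mW: "m \<in> W" using e by (intro subsetD[OF e(2)]) simp
  have cm: "?c m = 0" unfolding m_def cross_from_combination by (simp add: cross_from_def)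
  have dm: "?d m = \<delta> * ?L" unfolding m_def along_combination by (simp add: along_def)
  have "m \<in> N y" if "y \<in> F" for y
  proof -
    have "?c y * sgn (?c y) > 0" using nz[OF that] by (simp flip: abs_sgn)
    moreover have "(?c y * sgn (?c y)) * (\<delta> * ?L) < (?c y * sgn (?c y)) * ?L"
      using \<delta> L calculation by (intro mult_strict_left_mono) auto
    ultimately show ?thesis using \<delta> L
      by (simp add: N_def cm dm algebra_simps)
  qed
  then have mV: "m \<in> V" using mW dm \<delta> L by (auto simp: V_def)
  \<comment> \<open>The quarter turn of \<open>q - p\<close>. Moving along it raises
    \<open>?c\<close> at rate \<open>?L\<close>, so small shifts of \<open>m\<close> in both
    directions show that both halves are nonempty.\<close>
  define u :: point where "u = (- (snd q - snd p), fst q - fst p)"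
  have cu: "?c (m + s *\<^sub>R u) = s * ?L" for s
  proof -
    have "?c (m + s *\<^sub>R u) = ?c m + s * ?L"
      by (simp add: cross_from_def u_def along_def algebra_simps)
    then show ?thesis using cm by simp
  qed
  obtain \<epsilon> where \<epsilon>: "\<epsilon> > 0" "ball m \<epsilon> \<subseteq> V" using openV mV open_contains_ball by blast
  define s where "s = \<epsilon> / (2 * (norm u + 1))"
  have "norm u + 1 > 0" by (simp add: add_nonneg_pos)
  then have s: "s > 0" using \<epsilon> by (simp add: s_def)
  have "s * norm u < \<epsilon>"
  proof -
    have "s * norm u \<le> s * (norm u + 1)" using s by simp
    also have "\<dots> = \<epsilon> / 2" using \<open>norm u + 1 > 0\<close> by (simp add: s_def field_simps)
    finally show ?thesis using \<epsilon> by simp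
  qed
  then have inV: "m + s *\<^sub>R u \<in> V" "m + (- s) *\<^sub>R u \<in> V"
    using s by (auto intro!: subsetD[OF \<epsilon>(2)] simp: dist_norm)
  define W1 where "W1 = V \<inter> {x. 0 < ?c x}"
  define W2 where "W2 = V \<inter> {x. ?c x < 0}"
  have meet: "closed_segment x y \<inter> closed_segment p q \<noteq> {}"
    if x: "x \<in> V" "0 < ?c x" and y: "y \<in> V" "?c y < 0" for x y
  proof (rule segments_meet[OF assms(3) x(2) y(2)])
    have d: "0 < ?d x" "?d x < ?L" "0 < ?d y" "?d y < ?L" using x y by (auto simp: V_def)
    have "?c x * ?d y > 0" "?c y * ?d x < 0"
      using d x(2) y(2) by (simp_all add: mult_neg_pos)
    then show "0 \<le> ?c x * ?d y - ?c y * ?d x" by linarith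
    have "?c x * ?d y \<le> ?c x * ?L" "(- ?c y) * ?d x \<le> (- ?c y) * ?L"
      using d x(2) y(2) by (intro mult_left_mono; simp)+
    then show "?c x * ?d y - ?c y * ?d x \<le> (?c x - ?c y) * ?L"
      by (simp add: algebra_simps)
  qed
  have meet2: "closed_segment x y \<inter> closed_segment p q \<noteq> {}" if x: "x \<in> W1" and y: "y \<in> F2" for x y
  proof (rule segments_meet[OF assms(3)])
    have "x \<in> N y" using x y by (auto simp: W1_def V_def F2_def)
    then show "0 \<le> ?c x * ?d y - ?c y * ?d x" "?c x * ?d y - ?c y * ?d x \<le> (?c x - ?c y) * ?L"
      using y by (auto simp: N_def F2_def left_diff_distrib algebra_simps)
  qed (use x y in \<open>auto simp: W1_def F2_def\<close>)
  have meet1: "closed_segment y x \<inter> closed_segment p q \<noteq> {}" if x: "x \<in> W2" and y: "y \<in> F1" for x y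
  proof (rule segments_meet[OF assms(3)])
    have "x \<in> N y" using x y by (auto simp: W2_def V_def F1_def)
    then show "0 \<le> ?c y * ?d x - ?c x * ?d y" "?c y * ?d x - ?c x * ?d y \<le> (?c y - ?c x) * ?L"
      using y by (auto simp: N_def F1_def algebra_simps)
  qed (use x y in \<open>auto simp: W2_def F1_def\<close>)
  show thesis
  proof (rule that)
    show "open W1" "open W2"
      unfolding W1_def W2_def using openV
      by (auto intro!: open_Int open_Collect_less continuous_intros)
    have "m + s *\<^sub>R u \<in> W1" "m + (- s) *\<^sub>R u \<in> W2"
      using inV s L unfolding W1_def W2_def by (simp_all only: Int_iff mem_Collect_eq cu) simp_all
    then show "W1 \<noteq> {}" "W2 \<noteq> {}" by blast+
    show "W1 \<subseteq> W" "W2 \<subseteq> W" by (auto simp: W1_def W2_def V_def)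
    show "F1 \<union> F2 = F" using nz by (fastforce simp: F1_def F2_def)
    show "F1 \<inter> F2 = {}" by (auto simp: F1_def F2_def)
    show "\<forall>x\<in>W1. \<forall>y\<in>W2 \<union> F2. closed_segment x y \<inter> closed_segment p q \<noteq> {}"
    proof (intro ballI)
      fix x y assume xy: "x \<in> W1" "y \<in> W2 \<union> F2"
      show "closed_segment x y \<inter> closed_segment p q \<noteq> {}"
      proof (cases "y \<in> F2")
        case False
        then show ?thesis using xy meet[of x y] by (auto simp: W1_def W2_def)
      qed (use xy meet2 in blast)
    qed
    show "\<forall>x\<in>W2. \<forall>y\<in>F1. closed_segment x y \<inter> closed_segment p q \<noteq> {}"
      using meet1 by (simp add: closed_segment_commute)
  qed
qed

section \<open>Prefixes of inputs\<close>

text \<open>Parity of the length is left out, since the adversary reasons about every prefix of the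
  final input.\<close>

definition admissible :: "real \<Rightarrow> request list \<Rightarrow> bool" where
  "admissible U I \<longleftrightarrow> general_position (map fst I) \<and> (\<forall>r\<in>set I. snd r = 1 \<or> snd r = U)"

section \<open>Fresh points in general position\<close>

lemma interior_Union_closed_empty:
  assumes "finite \<F>" "\<And>C. C \<in> \<F> \<Longrightarrow> closed C \<and> interior C = {}"
  shows "interior (\<Union>\<F>) = {}"
  using assms
proof (induction \<F>)
  case (insert C \<F>)
  then have "closed C" "interior C = {}" "interior (\<Union>\<F>) = {}" by auto
  then show ?case by (simp add: interior_closed_Un_empty_interior)
qed simp

text \<open>The lines through earlier points are finitely many closed sets with empty interior, so
  they cannot cover an open window.\<close>

lemma admissible_extend:
  assumes "admissible U I" "open W" "W \<noteq> {}" "w = 1 \<or> w = U"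
  obtains p where "p \<in> W" "admissible U (I @ [(p, w)])"
proof -
  define P where "P = set (map fst I)"
  \<comment> \<open>Pairs with \<open>a = b\<close> give the earlier points themselves, so avoiding
    the union also makes \<open>p\<close> new.\<close>
  define \<F> where "\<F> = (\<lambda>(a, b). affine hull {a, b}) ` (P \<times> P)"
  have "interior (\<Union>\<F>) = {}"
  proof (rule interior_Union_closed_empty)
    show "finite \<F>" by (simp add: \<F>_def P_def)
    fix C assume "C \<in> \<F>"
    then obtain a b where C: "C = affine hull {a, b}" by (auto simp: \<F>_def)
    have "card {a, b} \<le> DIM(real \<times> real)" by (simp add: card_insert_if)
    then show "closed C \<and> interior C = {}"
      unfolding C by (auto intro!: empty_interior_affine_hull closed_affine_hull)
  qed
  then have "\<not> W \<subseteq> \<Union>\<F>" using assms(2,3) interior_maximal by blast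
  then obtain p where p: "p \<in> W" and off: "\<And>a b. a \<in> P \<Longrightarrow> b \<in> P \<Longrightarrow> p \<notin> affine hull {a, b}"
    unfolding \<F>_def by blast
  have new: "p \<notin> P" using off[of p p] by (auto simp: hull_inc)
  have ncol: "\<not> collinear {a, b, p}" if "a \<in> P" "b \<in> P" "a \<noteq> b" for a b
    using off[OF that(1,2)] that(3) collinear_3_affine_hull by blast
  have "general_position (map fst I @ [p])"
    unfolding general_position_def
  proof (intro conjI ballI impI)
    have old: "general_position (map fst I)" using assms(1) by (simp add: admissible_def)
    then show "distinct (map fst I @ [p])" using new by (simp add: general_position_def P_def)
    fix a b c assume abc: "a \<in> set (map fst I @ [p])" "b \<in> set (map fst I @ [p])"
      "c \<in> set (map fst I @ [p])" "a \<noteq> b \<and> b \<noteq> c \<and> a \<noteq> c"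
    then consider "a \<in> P" "b \<in> P" "c \<in> P" | "a = p" "b \<in> P" "c \<in> P" | "b = p" "a \<in> P" "c \<in> P"
      | "c = p" "a \<in> P" "b \<in> P" by (auto simp: P_def)
    then show "\<not> collinear {a, b, c}"
    proof cases
      case 1 then show ?thesis using old abc(4) by (auto simp: general_position_def P_def)
    next
      case 2 then show ?thesis using ncol[of b c] abc(4) by (simp add: insert_commute)
    next
      case 3 then show ?thesis using ncol[of a c] abc(4) by (simp add: insert_commute)
    next
      case 4 then show ?thesis using ncol[of a b] abc(4) by simp
    qed
  qed
  then have "admissible U (I @ [(p, w)])" using assms(1,4) by (auto simp: admissible_def)
  with p show thesis using that by blast
qed

section \<open>Growth of the matching and validity on prefixes\<close>

lemma matching_snoc:
  "matching A (I @ [r]) =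
     matching A I \<union> (case A (I @ [r]) of None \<Rightarrow> {} | Some j \<Rightarrow> {(j, length I)})"
  by (auto simp: matching_def less_Suc_eq split: option.splits)

lemma edge_segment_snoc:
  "fst e < length I \<Longrightarrow> snd e < length I \<Longrightarrow> edge_segment (I @ [r]) e = edge_segment I e"
  by (simp add: edge_segment_def nth_append)

lemma valid_run_bounds:
  assumes "valid_run A I" "e \<in> matching A I"
  shows "fst e < snd e" "snd e < length I" "fst e < length I"
proof -
  show 1: "fst e < snd e" using assms by (auto simp: valid_run_def split: prod.splits)
  show "snd e < length I" using assms(2) by (auto simp: matching_def)
  with 1 show "fst e < length I" by simp
qed

lemma valid_run_butlast:
  assumes "valid_run A (I @ [r])"
  shows "valid_run A I"
proof -
  have sub: "matching A I \<subseteq> matching A (I @ [r])" by (auto simp: matching_snoc)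
  have len: "snd e < length I" if "e \<in> matching A I" for e using that by (auto simp: matching_def)
  have lt: "fst e < snd e" if "e \<in> matching A I" for e
    using assms sub that valid_run_bounds(1) by blast
  have seg: "edge_segment (I @ [r]) e = edge_segment I e" if "e \<in> matching A I" for e
    using len[OF that] lt[OF that] by (intro edge_segment_snoc) auto
  show ?thesis unfolding valid_run_def
  proof (intro conjI ballI impI)
    fix e assume "e \<in> matching A I"
    then show "case e of (j, i) \<Rightarrow> j < i" using lt by (auto split: prod.splits)
  next
    fix e f assume ef: "e \<in> matching A I" "f \<in> matching A I" "e \<noteq> f"
    then have *: "{fst e, snd e} \<inter> {fst f, snd f} = {} \<and>
        edge_segment (I @ [r]) e \<inter> edge_segment (I @ [r]) f = {}"
      using assms sub unfolding valid_run_def by blast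
    show "{fst e, snd e} \<inter> {fst f, snd f} = {}" using * by blast
    show "edge_segment I e \<inter> edge_segment I f = {}" using * ef seg by metis
  qed
qed

lemma two_weight_input_admissible:
  assumes "U > 1" "admissible U I" "even (length I)"
  shows "two_weight_input U I"
proof -
  have "snd r > 0" if "r \<in> set I" for r
    using assms(1,2) that unfolding admissible_def by fastforce
  then show ?thesis
    using assms by (simp add: two_weight_input_def ownm_input_def admissible_def)
qed

text \<open>The algorithm is bound only on even inputs. An odd prefix is completed by one more
  point, and validity is inherited by prefixes.\<close>

lemma valid_run_admissible:
  assumes "U > 1" "two_weight_algorithm U A" "admissible U I"
  shows "valid_run A I"
proof -
  have even: "valid_run A J" if "admissible U J" "even (length J)" for J
    using assms(1,2) that two_weight_input_admissible by (simp add: two_weight_algorithm_def)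
  show ?thesis
  proof (cases "even (length I)")
    case False
    obtain p where "admissible U (I @ [(p, 1)])"
      using admissible_extend[OF assms(3) open_UNIV] by blast
    then show ?thesis using even[of "I @ [(p, 1)]"] False valid_run_butlast by auto
  qed (use even assms in blast)
qed

section \<open>Profit and total weight after one more request\<close>

lemma OPT_snoc: "OPT (I @ [r]) = OPT I + snd r"
  by (simp add: OPT_def nth_append)

text \<open>Long games thus have large total weight, so no additive constant can make up for a
  linear deficit.\<close>

lemma length_le_OPT:
  assumes "U > 1" "admissible U I"
  shows "real (length I) \<le> OPT I"
proof -
  have "(\<Sum>k<length I. 1) \<le> OPT I"
  proof (unfold OPT_def, rule sum_mono)
    fix k assume "k \<in> {..<length I}"
    then have "I ! k \<in> set I" by simp
    then have "snd (I ! k) = 1 \<or> snd (I ! k) = U" using assms(2) by (simp add: admissible_def)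
    then show "1 \<le> snd (I ! k)" using assms(1) by linarith
  qed
  then show ?thesis by simp
qed

lemma matched_less_length:
  assumes "valid_run A I" "j \<in> matched A I"
  shows "j < length I"
proof -
  obtain e where "e \<in> matching A I" "j = fst e \<or> j = snd e"
    using assms(2) by (auto simp: matched_def)
  then show ?thesis using valid_run_bounds(2,3)[OF assms(1)] by blast
qed

lemma ALG_snoc_None:
  assumes "valid_run A I" "A (I @ [r]) = None"
  shows "ALG A (I @ [r]) = ALG A I"
proof -
  have "matched A (I @ [r]) = matched A I" using assms by (simp add: matched_def matching_snoc)
  then show ?thesis unfolding ALG_def
    using matched_less_length[OF assms(1)] by (intro sum.cong) (auto simp: nth_append)
qed

lemma ALG_snoc_Some:
  assumes "valid_run A (I @ [r])" "A (I @ [r]) = Some q"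
  shows "q < length I" "q \<notin> matched A I" "ALG A (I @ [r]) = ALG A I + snd r + snd (I ! q)"
proof -
  have v: "valid_run A I" using assms valid_run_butlast by blast
  have e: "(q, length I) \<in> matching A (I @ [r])" using assms by (simp add: matching_snoc)
  then show q: "q < length I" using valid_run_bounds(1)[OF assms(1) e] by simp
  show nq: "q \<notin> matched A I"
  proof
    assume "q \<in> matched A I"
    then obtain f where f: "f \<in> matching A I" "q \<in> {fst f, snd f}" by (auto simp: matched_def)
    then have "f \<in> matching A (I @ [r])" "f \<noteq> (q, length I)"
      using valid_run_bounds(2)[OF v f(1)] by (auto simp: matching_snoc)
    then have "{fst f, snd f} \<inter> {q, length I} = {}"
      using assms(1) e unfolding valid_run_def by (metis fst_conv snd_conv)
    then show False using f(2) by blast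
  qed
  have "matched A (I @ [r]) = insert (length I) (insert q (matched A I))"
    using assms by (auto simp: matched_def matching_snoc)
  moreover have "finite (matched A I)" "length I \<notin> insert q (matched A I)"
    using matched_less_length[OF v] q finite_subset[of _ "{..<length I}"] by auto
  ultimately have "ALG A (I @ [r]) = snd r + (snd (I ! q) + (\<Sum>k\<in>matched A I. snd ((I @ [r]) ! k)))"
    using nq q by (simp add: ALG_def nth_append)
  also have "(\<Sum>k\<in>matched A I. snd ((I @ [r]) ! k)) = ALG A I"
    unfolding ALG_def using matched_less_length[OF v] by (intro sum.cong) (auto simp: nth_append)
  finally show "ALG A (I @ [r]) = ALG A I + snd r + snd (I ! q)" by simp
qed


section \<open>Regions that see few unmatched points\<close>

text \<open>Meeting one existing edge rules out the edge from \<open>x\<close> to \<open>y\<close>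
  for good, as matches are irrevocable.\<close>

definition blocked :: "strategy \<Rightarrow> request list \<Rightarrow> point \<Rightarrow> point \<Rightarrow> bool" where
  "blocked A I x y \<longleftrightarrow> (\<exists>e\<in>matching A I. closed_segment x y \<inter> edge_segment I e \<noteq> {})"

text \<open>A point placed in the window \<open>W\<close> can be matched only with an element of \<open>S\<close>.\<close>

definition region :: "strategy \<Rightarrow> request list \<Rightarrow> point set \<Rightarrow> nat set \<Rightarrow> bool" where
  "region A I W S \<longleftrightarrow> open W \<and> W \<noteq> {} \<and> S \<subseteq> {..<length I} \<and>
     (\<forall>x\<in>W. \<forall>j<length I. j \<notin> S \<longrightarrow> j \<notin> matched A I \<longrightarrow> blocked A I x (fst (I ! j)))"

text \<open>Requests in one window then leave the region of the other intact, since they cannot be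
  matched from there.\<close>

definition separated :: "strategy \<Rightarrow> request list \<Rightarrow> point set \<Rightarrow> point set \<Rightarrow> bool" where
  "separated A I W W' \<longleftrightarrow> (\<forall>x\<in>W. \<forall>y\<in>W'. blocked A I x y)"

text \<open>The head of the list is the region in play. As separation is symmetric,
  \<open>sorted_wrt\<close> states it for all pairs of distinct positions without comparing a window
  to itself.\<close>

definition layout :: "real \<Rightarrow> strategy \<Rightarrow> request list \<Rightarrow> (point set \<times> nat set) list \<Rightarrow> bool" where
  "layout U A I T \<longleftrightarrow> admissible U I \<and> (\<forall>(W, S)\<in>set T. region A I W S) \<and>
     sorted_wrt (\<lambda>(W, _) (W', _). separated A I W W') T"

lemma blocked_commute: "blocked A I x y = blocked A I y x"
  by (simp add: blocked_def closed_segment_commute)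

lemma separated_commute: "separated A I W W' = separated A I W' W"
  unfolding separated_def using blocked_commute by blast

lemma blocked_snoc:
  assumes "valid_run A I" "blocked A I x y"
  shows "blocked A (I @ [r]) x y"
proof -
  obtain e where e: "e \<in> matching A I" "closed_segment x y \<inter> edge_segment I e \<noteq> {}"
    using assms(2) by (auto simp: blocked_def)
  then have "edge_segment (I @ [r]) e = edge_segment I e"
    using valid_run_bounds[OF assms(1)] by (simp add: edge_segment_snoc)
  then show ?thesis using e unfolding blocked_def matching_snoc by blast
qed

lemma matched_snoc_subset: "matched A I \<subseteq> matched A (I @ [r])"
  by (auto simp: matched_def matching_snoc)

lemma region_snoc:
  assumes "valid_run A I" "region A I W S" "\<And>x. x \<in> W \<Longrightarrow> blocked A I x p"
  shows "region A (I @ [(p, w)]) W S"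
  unfolding region_def
proof (intro conjI ballI allI impI)
  show "open W" "W \<noteq> {}" "S \<subseteq> {..<length (I @ [(p, w)])}"
    using assms(2) by (auto simp: region_def)
  fix x j assume x: "x \<in> W" and j: "j < length (I @ [(p, w)])" "j \<notin> S" "j \<notin> matched A (I @ [(p, w)])"
  have "blocked A I x (fst ((I @ [(p, w)]) ! j))"
  proof (cases "j < length I")
    case True
    then have "blocked A I x (fst (I ! j))"
      using assms(2) x j matched_snoc_subset unfolding region_def by blast
    then show ?thesis using True by (simp add: nth_append)
  next
    case False
    then show ?thesis using j(1) assms(3)[OF x] by (simp add: nth_append)
  qed
  then show "blocked A (I @ [(p, w)]) x (fst ((I @ [(p, w)]) ! j))"
    using blocked_snoc assms(1) by blast
qed

lemma layout_Cons:
  "layout U A I ((W, S) # T) \<longleftrightarrow>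
     layout U A I T \<and> region A I W S \<and> (\<forall>(W', S')\<in>set T. separated A I W W')"
  by (auto simp: layout_def)

lemma layout_snoc:
  assumes "valid_run A I" "layout U A I ((W, S) # T)" "p \<in> W" "admissible U (I @ [(p, w)])"
  shows "layout U A (I @ [(p, w)]) T"
  unfolding layout_def
proof (intro conjI ballI)
  show "admissible U (I @ [(p, w)])" by fact
  fix R assume R: "R \<in> set T"
  obtain W' S' where R': "R = (W', S')" by (cases R)
  have "region A I W' S'" "separated A I W W'"
    using assms(2) R R' by (auto simp: layout_def)
  then have "region A (I @ [(p, w)]) W' S'"
    using assms(1,3) by (intro region_snoc) (auto simp: separated_def blocked_commute)
  then show "case R of (W, S) \<Rightarrow> region A (I @ [(p, w)]) W S" using R' by simp
next
  show "sorted_wrt (\<lambda>(W, _) (W', _). separated A (I @ [(p, w)]) W W') T"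
  proof (rule sorted_wrt_mono_rel)
    show "sorted_wrt (\<lambda>(W, _) (W', _). separated A I W W') T"
      using assms(2) by (simp add: layout_def)
  qed (auto simp: separated_def blocked_snoc[OF assms(1)])
qed

text \<open>Validity forces the partner of a new point into \<open>S\<close>, all other unmatched
  points being hidden behind edges. The new edge then splits the window by
  \<open>split_window\<close>. The regions in \<open>T\<close> stay as they are because
  \<open>W\<close> is separated from them.\<close>

lemma layout_step:
  assumes U: "U > 1" and alg: "two_weight_algorithm U A"
    and lay: "layout U A I ((W, S) # T)" and w: "w = 1 \<or> w = U"
  obtains (unmatched) p where
      "layout U A (I @ [(p, w)]) ((W, insert (length I) S) # T)" "ALG A (I @ [(p, w)]) = ALG A I"
  | (matched) p q W1 S1 W2 S2 where
      "q \<in> S" "S1 \<inter> S2 = {}" "S1 \<union> S2 = S - {q}"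
      "layout U A (I @ [(p, w)]) ((W1, S1) # (W2, S2) # T)"
      "ALG A (I @ [(p, w)]) = ALG A I + w + snd (I ! q)"
proof -
  define n where "n = length I"
  have adm: "admissible U I" and reg: "region A I W S"
    and sep: "\<And>W' S'. (W', S') \<in> set T \<Longrightarrow> separated A I W W'"
    using lay by (auto simp: layout_def)
  have W: "open W" "W \<noteq> {}" and Sn: "S \<subseteq> {..<n}"
    and out: "\<And>x j. x \<in> W \<Longrightarrow> j < n \<Longrightarrow> j \<notin> S \<Longrightarrow> j \<notin> matched A I \<Longrightarrow> blocked A I x (fst (I ! j))"
    using reg by (auto simp: region_def n_def)
  obtain p where p: "p \<in> W" and adm': "admissible U (I @ [(p, w)])"
    using admissible_extend[OF adm W w] by blast
  define I' where "I' = I @ [(p, w)]"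
  have len: "length I' = Suc n" by (simp add: I'_def n_def)
  have old: "I' ! j = I ! j" if "j < n" for j using that by (simp add: I'_def n_def nth_append)
  have new: "I' ! n = (p, w)" by (simp add: I'_def n_def)
  have v: "valid_run A I" "valid_run A I'"
    using valid_run_admissible[OF U alg] adm adm' by (auto simp: I'_def)
  have layT: "layout U A I' T" using layout_snoc[OF v(1) lay p adm'] by (simp add: I'_def)
  have keep: "blocked A I' x y" if "blocked A I x y" for x y
    using blocked_snoc[OF v(1) that] by (simp add: I'_def)
  have sepT: "\<forall>(W', S')\<in>set T. separated A I' V W'" if "V \<subseteq> W" for V
  proof (intro ballI)
    fix R assume R: "R \<in> set T"
    obtain W' S' where R': "R = (W', S')" by (cases R)
    then have "separated A I W W'" using sep R by simp
    then show "case R of (W', S') \<Rightarrow> separated A I' V W'"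
      using R' keep that unfolding separated_def by blast
  qed
  show thesis
  proof (cases "A I'")
    case None
    have "region A I' W (insert n S)"
      unfolding region_def
    proof (intro conjI ballI allI impI)
      show "open W" "W \<noteq> {}" "insert n S \<subseteq> {..<length I'}" using W Sn len by auto
      fix x j assume "x \<in> W" "j < length I'" "j \<notin> insert n S" "j \<notin> matched A I'"
      moreover from this have "j < n" using len by auto
      moreover have "matched A I \<subseteq> matched A I'" by (simp add: I'_def matched_snoc_subset)
      ultimately have "blocked A I x (fst (I ! j))" using out by blast
      then show "blocked A I' x (fst (I' ! j))" using keep old \<open>j < n\<close> by simp
    qed
    then have "layout U A I' ((W, insert n S) # T)"
      using layT sepT[of W] by (simp add: layout_Cons)
    moreover have "ALG A I' = ALG A I" using ALG_snoc_None v(1) None by (simp add: I'_def)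
    ultimately show thesis by (intro unmatched[of p]) (simp_all only: I'_def n_def)
  next
    case (Some q)
    have q: "q < n" "q \<notin> matched A I" and gain: "ALG A I' = ALG A I + w + snd (I ! q)"
      using ALG_snoc_Some[of A I "(p, w)" q] v(2) Some by (auto simp: I'_def n_def)
    have edges: "matching A I' = insert (q, n) (matching A I)"
      using Some by (simp add: I'_def n_def matching_snoc)
    have seg: "edge_segment I' (q, n) = closed_segment p (fst (I ! q))"
      by (simp add: edge_segment_def new old q closed_segment_commute)
    have qS: "q \<in> S"
    proof (rule ccontr)
      assume "q \<notin> S"
      then have "blocked A I p (fst (I ! q))" using out p q by blast
      then obtain e where e: "e \<in> matching A I" "closed_segment p (fst (I ! q)) \<inter> edge_segment I e \<noteq> {}"
        by (auto simp: blocked_def)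
      have b: "snd e < n" "fst e < n" using valid_run_bounds[OF v(1) e(1)] by (auto simp: n_def)
      then have "edge_segment I' e = edge_segment I e"
        by (simp add: I'_def n_def edge_segment_snoc)
      then have "edge_segment I' (q, n) \<inter> edge_segment I' e \<noteq> {}" using e(2) seg by simp
      moreover have "(q, n) \<noteq> e" "(q, n) \<in> matching A I'" "e \<in> matching A I'"
        using b e(1) edges by auto
      ultimately show False using v(2) unfolding valid_run_def by blast
    qed
    have gp: "general_position (map fst I')" using adm' by (simp add: admissible_def I'_def)
    have dist: "fst (I' ! i) \<noteq> fst (I' ! j)" if "i < Suc n" "j < Suc n" "i \<noteq> j" for i j
    proof -
      have "distinct (map fst I')" using gp by (simp add: general_position_def)
      then show ?thesis using that len nth_eq_iff_index_eq[of "map fst I'" i j] by simp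
    qed
    define F where "F = (\<lambda>j. fst (I ! j)) ` (S - {q})"
    have pq: "p \<noteq> fst (I ! q)" using dist[of n q] q by (simp add: new old)
    have finS: "finite S" using Sn finite_subset by blast
    have finF: "finite F" using finS by (simp add: F_def)
    have ncol: "\<not> collinear {p, fst (I ! q), y}" if "y \<in> F" for y
    proof -
      obtain j where j: "j \<in> S" "j \<noteq> q" "y = fst (I ! j)" using \<open>y \<in> F\<close> by (auto simp: F_def)
      then have jn: "j < n" using Sn by auto
      have "fst (I' ! n) \<in> set (map fst I')" "fst (I' ! q) \<in> set (map fst I')"
        "fst (I' ! j) \<in> set (map fst I')" using len q jn by auto
      moreover have "fst (I' ! n) \<noteq> fst (I' ! q)" "fst (I' ! q) \<noteq> fst (I' ! j)"
        "fst (I' ! n) \<noteq> fst (I' ! j)" using dist q jn j(2) by auto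
      ultimately have "\<not> collinear {fst (I' ! n), fst (I' ! q), fst (I' ! j)}"
        using gp unfolding general_position_def by blast
      then show ?thesis using new old q jn j by simp
    qed
    \<comment> \<open>The edge runs from \<open>p\<close> to its partner; \<open>F\<close> holds the
      other points of \<open>S\<close>, which general position keeps off its line.\<close>
    obtain W1 W2 F1 F2 where split: "open W1" "open W2" "W1 \<noteq> {}" "W2 \<noteq> {}" "W1 \<subseteq> W" "W2 \<subseteq> W"
      "F1 \<union> F2 = F" "F1 \<inter> F2 = {}"
      and hit1: "\<forall>x\<in>W1. \<forall>y\<in>W2 \<union> F2. closed_segment x y \<inter> closed_segment p (fst (I ! q)) \<noteq> {}"
      and hit2: "\<forall>x\<in>W2. \<forall>y\<in>F1. closed_segment x y \<inter> closed_segment p (fst (I ! q)) \<noteq> {}"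
      by (rule split_window[OF W(1) p pq finF]) (erule ncol, rule that)
    have block: "blocked A I' x y" if "closed_segment x y \<inter> closed_segment p (fst (I ! q)) \<noteq> {}" for x y
      using that edges seg by (auto simp: blocked_def)
    define S1 S2 where "S1 = {j \<in> S - {q}. fst (I ! j) \<in> F1}" and "S2 = {j \<in> S - {q}. fst (I ! j) \<in> F2}"
    have qn: "q \<in> matched A I'" "n \<in> matched A I'" using edges by (auto simp: matched_def)
    \<comment> \<open>Both halves alike: points of \<open>S\<close> across the new edge are hidden
      by it, unmatched points outside \<open>S\<close> were hidden from all of \<open>W\<close>
      before, and both ends of the new edge are matched.\<close>
    have half: "region A I' V {j \<in> S - {q}. fst (I ! j) \<in> G}"
      if V: "open V" "V \<noteq> {}" "V \<subseteq> W"
        and hit: "\<forall>x\<in>V. \<forall>y\<in>F - G. closed_segment x y \<inter> closed_segment p (fst (I ! q)) \<noteq> {}"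
      for V G
      unfolding region_def
    proof (intro conjI ballI allI impI)
      show "open V" "V \<noteq> {}" "{j \<in> S - {q}. fst (I ! j) \<in> G} \<subseteq> {..<length I'}"
        using V Sn len by auto
      fix x j assume x: "x \<in> V" and j: "j < length I'" "j \<notin> {j \<in> S - {q}. fst (I ! j) \<in> G}" "j \<notin> matched A I'"
      have jq: "j \<noteq> q" "j < n" using qn j len by (auto simp: less_Suc_eq)
      have "blocked A I' x (fst (I ! j))"
      proof (cases "j \<in> S")
        case True
        then have "fst (I ! j) \<in> F - G" using j(2) jq by (auto simp: F_def)
        then show ?thesis using hit x block by blast
      next
        case False
        moreover have "j \<notin> matched A I" using j(3) matched_snoc_subset[of A I "(p, w)"] by (auto simp: I'_def)
        ultimately show ?thesis using out keep jq x V(3) by blast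
      qed
      then show "blocked A I' x (fst (I' ! j))" using old jq by simp
    qed
    have "region A I' W1 S1" unfolding S1_def
      using split(1,3,5,7) hit1 by (intro half) auto
    moreover have "region A I' W2 S2" unfolding S2_def
      using split(2,4,6,7) hit2 by (intro half) auto
    moreover have "separated A I' W1 W2" using hit1 block by (auto simp: separated_def)
    ultimately have "layout U A I' ((W1, S1) # (W2, S2) # T)"
      using layT sepT split by (simp add: layout_Cons)
    moreover have "S1 \<inter> S2 = {}" "S1 \<union> S2 = S - {q}"
      using split(7,8) by (auto simp: S1_def S2_def F_def)
    ultimately show thesis
      using qS gain by (intro matched[of q S1 S2 p W1 W2]) (simp_all only: I'_def)
  qed
qed

lemma layout_swap:
  "layout U A I (R1 # R2 # T) \<Longrightarrow> layout U A I (R2 # R1 # T)"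
  by (cases R1; cases R2) (simp add: layout_Cons separated_commute)

lemma layout_tail: "layout U A I (R # T) \<Longrightarrow> layout U A I T"
  by (auto simp: layout_def)

section \<open>The adversary\<close>

definition rho :: "real \<Rightarrow> real" where
  "rho U = 1 / 3 + 2 / (3 * U + 3)"

text \<open>The balance equation \<open>3 * rho U * (U + 1) = U + 3\<close>, solved for the product
  so that later estimates become linear.\<close>

lemma rho_times:
  assumes "U > 1"
  shows "rho U * U = U / 3 + 1 - rho U"
  using assms by (simp add: rho_def field_simps)

text \<open>The first bound amounts to \<open>2 - 2 * rho U \<le> 4 * rho U\<close>, for abandoning
  four unit points; the second makes the price \<open>2 - 2 * rho U\<close> nonnegative; the third,
  by \<open>rho_times\<close>, amounts to \<open>2 - 2 * rho U \<le> rho U * U\<close>, for an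
  unmatched point of weight \<open>U\<close>.\<close>

lemma rho_bounds:
  assumes "U > 1"
  shows "1 / 3 \<le> rho U" "rho U \<le> 1" "1 - U / 3 \<le> rho U"
proof -
  show "1 / 3 \<le> rho U" "rho U \<le> 1" using assms by (simp_all add: rho_def field_simps)
  \<comment> \<open>Clearing denominators turns the claim into this inequality.\<close>
  have "U * 1 \<le> U * U" using assms by (intro mult_left_mono) auto
  then show "1 - U / 3 \<le> rho U" using assms by (simp add: rho_def field_simps)
qed

definition unit_weights :: "request list \<Rightarrow> (point set \<times> nat set) list \<Rightarrow> bool" where
  "unit_weights I T \<longleftrightarrow> (\<forall>(W, S)\<in>set T. \<forall>j\<in>S. j < length I \<and> snd (I ! j) = 1)"

definition standing :: "real \<Rightarrow> strategy \<Rightarrow> request list \<Rightarrow> (point set \<times> nat set) list \<Rightarrow> bool" where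
  "standing U A I T \<longleftrightarrow> layout U A I T \<and> unit_weights I T \<and>
     ALG A I \<le> rho U * OPT I + (2 - 2 * rho U) * (real (length T) - 1)
       - rho U * (\<Sum>(W, S)\<leftarrow>T. real (card S))"

lemma unit_weights_snoc: "unit_weights I T \<Longrightarrow> unit_weights (I @ [r]) T"
  by (fastforce simp: unit_weights_def nth_append)

lemma unit_weights_Cons:
  "unit_weights I ((W, S) # T) \<longleftrightarrow> (\<forall>j\<in>S. j < length I \<and> snd (I ! j) = 1) \<and> unit_weights I T"
  by (simp add: unit_weights_def)

lemma standing_swap: "standing U A I (R1 # R2 # T) \<Longrightarrow> standing U A I (R2 # R1 # T)"
  by (cases R1; cases R2) (simp add: standing_def layout_swap unit_weights_Cons add.left_commute)

text \<open>No slack is lost, which is what fixes the price of a region. An unmatched point adds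
  \<open>rho U\<close> to the optimum term and to the subtracted term. A match earns 2, paid by
  \<open>rho U\<close> for the request, \<open>2 - 2 * rho U\<close> for the extra region and
  \<open>rho U\<close> for the partner that leaves the count.\<close>

lemma standing_unit_step:
  assumes "U > 1" "two_weight_algorithm U A" "standing U A I ((W, S) # T)"
  obtains (unmatched) I' S' where "length I' = Suc (length I)" "standing U A I' ((W, S') # T)"
      "card S' = Suc (card S)"
  | (matched) I' W1 S1 W2 S2 where "length I' = Suc (length I)"
      "standing U A I' ((W1, S1) # (W2, S2) # T)" "Suc (card S1 + card S2) = card S"
proof -
  have lay: "layout U A I ((W, S) # T)" and uw: "unit_weights I ((W, S) # T)"
    and profit: "ALG A I \<le> rho U * OPT I + (2 - 2 * rho U) * real (length T)
       - rho U * (real (card S) + (\<Sum>(W, S)\<leftarrow>T. real (card S)))"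
    using assms(3) by (auto simp: standing_def)
  have Sn: "S \<subseteq> {..<length I}" using uw by (auto simp: unit_weights_Cons)
  then have finS: "finite S" using finite_subset by blast
  show thesis
  proof (cases rule: layout_step[OF assms(1,2) lay, of 1])
    case (2 p)
    have card: "card (insert (length I) S) = Suc (card S)" using finS Sn by (subst card_insert_disjoint) auto
    have "unit_weights (I @ [(p, 1)]) ((W, insert (length I) S) # T)"
      using unit_weights_snoc[OF uw, of "(p, 1)"] by (auto simp: unit_weights_Cons)
    then have "standing U A (I @ [(p, 1)]) ((W, insert (length I) S) # T)"
      using 2 profit card by (simp add: standing_def OPT_snoc algebra_simps)
    then show thesis using card by (intro unmatched[of "I @ [(p, 1)]" "insert (length I) S"]) auto
  next
    case (3 p q W1 S1 W2 S2)
    have "finite (S1 \<union> S2)" using 3(3) finS by simp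
    then have fin: "finite S1" "finite S2" by simp_all
    have "card S1 + card S2 = card (S - {q})"
      using card_Un_disjoint[OF fin 3(2)] by (simp only: 3(3))
    then have card: "Suc (card S1 + card S2) = card S"
      using card_Suc_Diff1[OF finS 3(1)] by simp
    have uw': "unit_weights (I @ [(p, 1)]) ((W1, S1) # (W2, S2) # T)"
      using unit_weights_snoc[OF uw, of "(p, 1)"] 3(3) by (auto simp: unit_weights_Cons)
    have "snd (I ! q) = 1" using uw 3(1) by (simp add: unit_weights_Cons)
    moreover have "real (card S) = 1 + real (card S1) + real (card S2)" using card by linarith
    ultimately have "standing U A (I @ [(p, 1)]) ((W1, S1) # (W2, S2) # T)"
      using 3(4,5) uw' profit by (simp add: standing_def OPT_snoc algebra_simps)
    then show thesis using card by (intro matched[of "I @ [(p, 1)]" W1 S1 W2 S2]) auto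
  qed simp
qed

text \<open>No request is sent: the points of the region stop being counted, and the released
  \<open>4 * rho U\<close> or more pays for the lost region.\<close>

lemma standing_drop:
  assumes "U > 1" "standing U A I ((W, S) # T)" "card S \<ge> 4"
  shows "standing U A I T"
proof -
  have "rho U * 4 \<le> rho U * real (card S)"
    using rho_bounds[OF assms(1)] assms(3) by (intro mult_left_mono) auto
  then have "rho U * real (card S) \<ge> 2 - 2 * rho U"
    using rho_bounds[OF assms(1)] by linarith
  then show ?thesis using assms(2) layout_tail
    by (auto simp: standing_def unit_weights_Cons algebra_simps)
qed

text \<open>A match would need a partner in the empty set.\<close>

lemma layout_waste:
  assumes "U > 1" "two_weight_algorithm U A" "layout U A I ((W, {}) # T)"
  obtains p where "layout U A (I @ [(p, U)]) T" "ALG A (I @ [(p, U)]) = ALG A I"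
proof (cases rule: layout_step[OF assms, of U])
  case (2 p)
  show thesis using that[OF layout_tail[OF 2(1)] 2(2)] .
qed auto

lemma standing_leaf:
  assumes "U > 1" "two_weight_algorithm U A" "standing U A I ((W, S) # T)" "card S \<le> 1"
  shows "\<exists>I'. length I < length I' \<and> standing U A I' T"
proof -
  have lay: "layout U A I ((W, S) # T)" and uw: "unit_weights I ((W, S) # T)"
    and profit: "ALG A I \<le> rho U * OPT I + (2 - 2 * rho U) * real (length T)
       - rho U * (real (card S) + (\<Sum>(W, S)\<leftarrow>T. real (card S)))"
    using assms(3) by (auto simp: standing_def)
  have uwT: "unit_weights I T" using uw by (simp add: unit_weights_Cons)
  have "S \<subseteq> {..<length I}" using uw by (auto simp: unit_weights_Cons)
  then have finS: "finite S" using finite_subset by blast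
  note rho = rho_times[OF assms(1)] rho_bounds[OF assms(1)]
  show ?thesis
  proof (cases rule: layout_step[OF assms(1,2) lay, of U])
    case (2 p)
    \<comment> \<open>The region is dropped at once, so the point of weight \<open>U\<close> never
      enters the count of unit points.\<close>
    have "layout U A (I @ [(p, U)]) T" using 2(1) layout_tail by blast
    moreover have "2 - 2 * rho U \<le> rho U * U + rho U * real (card S)"
    proof -
      have "rho U * real (card S) \<ge> 0" using rho by simp
      then show ?thesis using rho by linarith
    qed
    ultimately have "standing U A (I @ [(p, U)]) T"
      using 2(2) profit uwT by (simp add: standing_def OPT_snoc unit_weights_snoc algebra_simps)
    then show ?thesis by (intro exI[of _ "I @ [(p, U)]"]) simp
  next
    case (3 p q W1 S1 W2 S2)
    \<comment> \<open>The only visible point is used up, so both parts are empty and each swallows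
      one more point of weight \<open>U\<close>.\<close>
    have S: "S = {q}"
      using 3(1) assms(4) finS by (auto simp: card_le_Suc0_iff_eq)
    then have empty: "S1 = {}" "S2 = {}" using 3(3) by auto
    have q: "snd (I ! q) = 1" using uw 3(1) by (simp add: unit_weights_Cons)
    obtain p1 where p1: "layout U A ((I @ [(p, U)]) @ [(p1, U)]) ((W2, {}) # T)"
      "ALG A ((I @ [(p, U)]) @ [(p1, U)]) = ALG A (I @ [(p, U)])"
      using layout_waste[OF assms(1,2) 3(4)[unfolded empty]] by blast
    obtain p2 where p2: "layout U A (((I @ [(p, U)]) @ [(p1, U)]) @ [(p2, U)]) T"
      "ALG A (((I @ [(p, U)]) @ [(p1, U)]) @ [(p2, U)]) = ALG A ((I @ [(p, U)]) @ [(p1, U)])"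
      using layout_waste[OF assms(1,2) p1(1)] by blast
    define J where "J = ((I @ [(p, U)]) @ [(p1, U)]) @ [(p2, U)]"
    have "layout U A J T" "unit_weights J T"
      unfolding J_def by (rule p2(1), intro unit_weights_snoc uwT)
    moreover have "ALG A J = ALG A I + U + 1" using p1 p2 3(5) q by (simp add: J_def)
    moreover have "OPT J = OPT I + 3 * U" unfolding J_def OPT_snoc by simp
    \<comment> \<open>The bound rises by \<open>3 * rho U * U\<close> for the requests and by
      \<open>rho U\<close> for \<open>q\<close>, and falls by \<open>2 - 2 * rho U\<close> for the
      region. By \<open>rho_times\<close> this is exactly the gain \<open>U + 1\<close>.\<close>
    ultimately have "standing U A J T"
      using profit rho S by (simp add: standing_def algebra_simps)
    then show ?thesis by (intro exI[of _ J]) (simp add: J_def)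
  qed simp
qed

text \<open>At most two regions are kept open. Unit points go to the first one, until it sees four
  unmatched points and is abandoned, or an edge cuts off a part that sees at most one.\<close>

definition open_position :: "real \<Rightarrow> strategy \<Rightarrow> request list \<Rightarrow> bool" where
  "open_position U A I \<longleftrightarrow> (\<exists>R. standing U A I [R]) \<or>
     (\<exists>W S R. standing U A I [(W, S), R] \<and> card S \<le> 3)"

lemma open_position_advance:
  assumes "U > 1" "two_weight_algorithm U A" "open_position U A I"
  shows "\<exists>I'. length I < length I' \<and> open_position U A I'"
proof -
  consider R where "standing U A I [R]" | W S R where "standing U A I [(W, S), R]" "card S \<le> 3"
    using assms(3) unfolding open_position_def by blast
  then show ?thesis
  proof cases
    case R: (1 R)
    obtain W S where WS: "R = (W, S)" by (cases R)
    show ?thesis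
    proof (cases rule: standing_unit_step[OF assms(1,2) R[unfolded WS]])
      case (1 I' S')
      then show ?thesis unfolding open_position_def by (intro exI[of _ I']) auto
    next
      case (2 I' W1 S1 W2 S2)
      have "open_position U A I'"
      proof (cases "card S1 \<le> 3")
        case True
        then show ?thesis using 2(2) unfolding open_position_def by blast
      next
        case False
        then have "standing U A I' [(W2, S2)]" using standing_drop[OF assms(1) 2(2)] by simp
        then show ?thesis unfolding open_position_def by blast
      qed
      then show ?thesis using 2(1) by (intro exI[of _ I']) simp
    qed
  next
    case (2 W S R)
    note st = 2(1) and S = 2(2)
    show ?thesis
    proof (cases rule: standing_unit_step[OF assms(1,2) st])
      case (1 I' S')
      have "open_position U A I'"
      proof (cases "card S' \<le> 3")
        case True
        then show ?thesis using 1(2) unfolding open_position_def by blast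
      next
        case False
        then have "standing U A I' [R]" using standing_drop[OF assms(1) 1(2)] by simp
        then show ?thesis unfolding open_position_def by blast
      qed
      then show ?thesis using 1(1) by (intro exI[of _ I']) simp
    next
      case (2 I' W1 S1 W2 S2)
      \<comment> \<open>The two parts have at most two points together, so one has at most one; it
        is moved to the front and closed, which leaves two regions again.\<close>
      obtain V1 P1 V2 P2 where P: "standing U A I' [(V1, P1), (V2, P2), R]" "card P1 \<le> 1" "card P2 \<le> 3"
      proof (cases "card S1 \<le> 1")
        case True
        then show ?thesis using that 2(2,3) S by simp
      next
        case False
        then show ?thesis using that[OF standing_swap[OF 2(2)]] 2(3) S by simp
      qed
      obtain J where "length I' < length J" "standing U A J [(V2, P2), R]"
        using standing_leaf[OF assms(1,2) P(1,2)] by blast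
      moreover from this have "open_position U A J" using P(3) unfolding open_position_def by blast
      ultimately show ?thesis using 2(1) by (intro exI[of _ J]) simp
    qed
  qed
qed

section \<open>From the endless game to the competitive ratio\<close>

lemma open_position_Nil: "open_position U A []"
proof -
  \<comment> \<open>With the whole plane as the only region, \<open>real (length T) - 1\<close> is
    zero and the bound starts at zero.\<close>
  have "standing U A [] [(UNIV, {})]"
    by (simp add: standing_def layout_def admissible_def general_position_def region_def
        unit_weights_def ALG_def OPT_def matched_def matching_def)
  then show ?thesis unfolding open_position_def by blast
qed

text \<open>The additive term is independent of the length of the game: the price of a region is at
  most 2, and at most two regions are open beyond the first.\<close>

lemma standing_profit:
  assumes "U > 1" "standing U A I T" "length T \<le> 3"
  shows "ALG A I \<le> rho U * OPT I + 4"
proof -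
  note rho = rho_bounds[OF assms(1)]
  have "(\<Sum>(W, S)\<leftarrow>T. real (card S)) \<ge> 0" by (intro sum_list_nonneg) auto
  then have "rho U * (\<Sum>(W, S)\<leftarrow>T. real (card S)) \<ge> 0" using rho by simp
  moreover have "(2 - 2 * rho U) * (real (length T) - 1) \<le> 2 * 2"
  proof -
    have "(2 - 2 * rho U) * (real (length T) - 1) \<le> (2 - 2 * rho U) * 2"
      using rho assms(3) by (intro mult_left_mono) auto
    also have "\<dots> \<le> 2 * 2" using rho by simp
    finally show ?thesis .
  qed
  ultimately show ?thesis using assms(2) unfolding standing_def by linarith
qed

lemma bad_input:
  assumes "U > 1" "two_weight_algorithm U A"
  shows "\<exists>I. two_weight_input U I \<and> real N \<le> OPT I \<and> ALG A I \<le> rho U * OPT I + 4"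
proof -
  have "\<exists>I. N \<le> length I \<and> open_position U A I"
  proof (induction N)
    case 0
    show ?case using open_position_Nil by blast
  next
    case (Suc N)
    then obtain I where "N \<le> length I" "open_position U A I" by blast
    then show ?case using open_position_advance[OF assms] by (meson Suc_leI le_less_trans)
  qed
  then obtain I where I: "N \<le> length I" "open_position U A I" by blast
  then obtain W S T where T: "standing U A I ((W, S) # T)" "length T \<le> 1"
    unfolding open_position_def by force
  \<comment> \<open>One more unit request repairs an odd length. It may split a region, whence three
    regions instead of two.\<close>
  have "\<exists>J T. N \<le> length J \<and> even (length J) \<and> standing U A J T \<and> length T \<le> 3"
  proof (cases "even (length I)")
    case True
    then show ?thesis using I(1) T by (intro exI[of _ I] exI[of _ "(W, S) # T"]) simp
  next
    case False
    show ?thesis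
    proof (cases rule: standing_unit_step[OF assms T(1)])
      case (1 I' S')
      then show ?thesis using I(1) T(2) False by (intro exI[of _ I'] exI[of _ "(W, S') # T"]) simp
    next
      case (2 I' W1 S1 W2 S2)
      then show ?thesis using I(1) T(2) False
        by (intro exI[of _ I'] exI[of _ "(W1, S1) # (W2, S2) # T"]) simp
    qed
  qed
  then obtain J T where J: "N \<le> length J" "even (length J)" "standing U A J T" "length T \<le> 3"
    by blast
  then have "admissible U J" by (simp add: standing_def layout_def)
  then have "two_weight_input U J" "real (length J) \<le> OPT J"
    using two_weight_input_admissible length_le_OPT assms(1) J(2) by blast+
  then show ?thesis using J standing_profit[OF assms(1)] by (intro exI[of _ J]) auto
qed

theorem theorem2:
  fixes U :: real and A :: strategy
  assumes "U > 1"
    and "two_weight_algorithm U A"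
  shows "competitive_ratio U A \<le> ereal (1 / 3 + 2 / (3 * U + 3))"
proof -
  have "\<rho> \<le> rho U" if comp: "competitive U A \<rho>" for \<rho>
  proof (rule ccontr)
    assume "\<not> \<rho> \<le> rho U"
    then have gap: "\<rho> - rho U > 0" by simp
    obtain c where c: "\<And>I. two_weight_input U I \<Longrightarrow> ALG A I \<ge> \<rho> * OPT I - c"
      using comp unfolding competitive_def by blast
    \<comment> \<open>Chosen so that the linear excess \<open>(\<rho> - rho U) * OPT I\<close> beats
      the additive constants 4 and \<open>c\<close> together.\<close>
    obtain N :: nat where N: "(4 + c) / (\<rho> - rho U) < real N" using reals_Archimedean2 by blast
    obtain I where I: "two_weight_input U I" "real N \<le> OPT I" "ALG A I \<le> rho U * OPT I + 4"
      using bad_input[OF assms] by blast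
    have "(4 + c) / (\<rho> - rho U) < OPT I" using N I(2) by linarith
    then have "4 + c < (\<rho> - rho U) * OPT I" using gap by (simp add: pos_divide_less_eq mult.commute)
    then show False using c[OF I(1)] I(3) by (simp add: algebra_simps)
  qed
  then show ?thesis unfolding competitive_ratio_def rho_def by (auto intro!: Sup_least)
qed

end
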